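(* Let $n\geq 1$, let $X_1,\ldots,X_n$ be exchangeable real-valued random variables defined on a common probability space with probability measure $\mathbb{P}$, put $\boldsymbol{X}=(X_1,\ldots,X_n)$, and let $\boldsymbol{Y}=(Y_1,\ldots,Y_n)$ with $Y_1\leq\cdots\leq Y_n$ be the vector of order statistics of $\boldsymbol{X}$. Then the conditional distribution of $\boldsymbol{X}$ given $\boldsymbol{Y}$ is given by \[ \mathbb{P}(\boldsymbol{X}\in B\mid \boldsymbol{Y})=\frac{1}{n!}\sum_{\boldsymbol{\pi}} I_B(Y_{\pi(1)},\ldots,Y_{\pi(n)}),\qquad B\in\mathcal{B}(\mathbb{R}^n), \] where, for each $B$, the equality holds almost surely, and the sum is taken over all $n!$ permutations $\boldsymbol{\pi}=(\pi(1),\ldots,\pi(n))$ of $\{1,\ldots,n\}$.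
   Context: Random variables $X_1,\ldots,X_n$ are exchangeable if for every permutation $\boldsymbol{\pi}$ of $\{1,\ldots,n\}$ the random vector $(X_{\pi(1)},\ldots,X_{\pi(n)})$ has the same distribution on $\mathbb{R}^n$ as $(X_1,\ldots,X_n)$. The order statistics $Y_1\leq\cdots\leq Y_n$ of $(X_1,\ldots,X_n)$ are the values $X_1,\ldots,X_n$ (counted with multiplicity) rearranged, pointwise on the probability space, in nondecreasing order. $\mathcal{B}(\mathbb{R}^n)$ is the Borel $\sigma$-field of $\mathbb{R}^n$, $I_B$ is the indicator function of $B$, and $\mathbb{P}(\boldsymbol{X}\in B\mid\boldsymbol{Y})=\mathbb{E}[I_B(\boldsymbol{X})\mid\sigma(\boldsymbol{Y})]$, where $\sigma(\boldsymbol{Y})$ is the $\sigma$-field generated by $\boldsymbol{Y}$. *)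

theory Defs
  imports "HOL-Probability.Probability" "HOL-Combinatorics.Permutations"
begin

text \<open>
  A point of \<open>\<real>\<^sup>n\<close> is a function on the index set \<open>{1..n}\<close>, extended by \<open>undefined\<close> outside of it.
  The product \<open>\<sigma>\<close>-algebra used here is the Borel \<open>\<sigma>\<close>-algebra of the product topology, see
  \<open>sets_Rn_eq_borel\<close> below.
\<close>

abbreviation Rn :: "nat \<Rightarrow> (nat \<Rightarrow> real) measure" where
  "Rn n \<equiv> Pi\<^sub>M {1..n} (\<lambda>_. borel)"

lemma sets_Rn_eq_borel:
  "sets (Rn n) =
     sigma_sets ({1..n} \<rightarrow>\<^sub>E UNIV) {U. openin (product_topology (\<lambda>_. euclideanreal) {1..n}) U}"
  (is "_ = sigma_sets ?S ?O")
proof (rule antisym)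
  have OS: "?O \<subseteq> Pow ?S"
    using openin_subset by fastforce
  define N where "N = sigma ?S ?O"
  have sN: "sets N = sigma_sets ?S ?O" and spN: "space N = ?S"
    using OS by (auto simp: N_def)
  have proj: "(\<lambda>f. f i) \<in> borel_measurable N" if i: "i \<in> {1..n}" for i
  proof (rule borel_measurableI)
    fix A :: "real set" assume "open A"
    then have "openin (product_topology (\<lambda>_. euclideanreal) {1..n})
                 {f \<in> topspace (product_topology (\<lambda>_. euclideanreal) {1..n}). f i \<in> A}"
      by (intro openin_continuous_map_preimage[OF continuous_map_product_projection] i)
        (simp add: open_openin[symmetric])
    moreover have "(\<lambda>f. f i) -` A \<inter> space N
        = {f \<in> topspace (product_topology (\<lambda>_. euclideanreal) {1..n}). f i \<in> A}"
      by (auto simp: spN)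
    ultimately show "(\<lambda>f. f i) -` A \<inter> space N \<in> sets N"
      unfolding sN by (auto intro!: sigma_sets.Basic)
  qed
  have "sets (Rn n) = sigma_sets ?S {{f \<in> ?S. f i \<in> A} | i A. i \<in> {1..n} \<and> A \<in> sets borel}"
    by (simp add: sets_PiM_single)
  also have "\<dots> \<subseteq> sets N"
  proof -
    have "{f \<in> ?S. f i \<in> A} \<in> sets N" if "i \<in> {1..n}" "A \<in> sets borel" for i A
    proof -
      have "(\<lambda>f. f i) -` A \<inter> space N \<in> sets N"
        using measurable_sets[OF proj] that by simp
      moreover have "(\<lambda>f. f i) -` A \<inter> space N = {f \<in> ?S. f i \<in> A}"
        by (auto simp: spN)
      ultimately show ?thesis by simp
    qed
    then show ?thesis
      unfolding spN[symmetric] by (intro sets.sigma_sets_subset) (auto simp: spN)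
  qed
  finally show "sets (Rn n) \<subseteq> sigma_sets ?S ?O" by (simp add: sN)
next
  obtain \<B> :: "real set set" where \<B>: "countable \<B>" "topological_basis \<B>"
    using ex_countable_basis by blast
  have "U \<in> sets (Rn n)" if U: "U \<in> ?O" for U
  proof -
    define \<C> where "\<C> = {b \<in> {1..n} \<rightarrow>\<^sub>E \<B>. Pi\<^sub>E {1..n} b \<subseteq> U}"
    have "countable \<C>"
      unfolding \<C>_def by (rule countable_subset[OF _ countable_PiE[of "{1..n}" "\<lambda>_. \<B>"]]) (use \<B> in auto)
    moreover have "Pi\<^sub>E {1..n} b \<in> sets (Rn n)" if "b \<in> \<C>" for b
    proof (rule sets_PiM_I_finite)
      fix i assume "i \<in> {1..n}"
      with that have "b i \<in> \<B>" by (auto simp: \<C>_def)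
      with \<B>(2) show "b i \<in> sets borel" by (simp add: topological_basis_open)
    qed simp
    moreover have "U = (\<Union>b\<in>\<C>. Pi\<^sub>E {1..n} b)"
    proof (intro equalityI subsetI)
      fix x assume "x \<in> U"
      then obtain V where V: "\<forall>i\<in>{1..n}. open (V i)" "x \<in> Pi\<^sub>E {1..n} V" "Pi\<^sub>E {1..n} V \<subseteq> U"
        using U by (auto simp: openin_product_topology_alt)
      have "\<exists>c\<in>\<B>. x i \<in> c \<and> c \<subseteq> V i" if "i \<in> {1..n}" for i
        using V that \<B>(2) by (metis PiE_mem topological_basisE)
      then obtain c where c: "\<And>i. i \<in> {1..n} \<Longrightarrow> c i \<in> \<B> \<and> x i \<in> c i \<and> c i \<subseteq> V i"
        by metis
      have xc: "x \<in> Pi\<^sub>E {1..n} (restrict c {1..n})"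
        using V(2) c by (auto simp: PiE_iff)
      have "Pi\<^sub>E {1..n} (restrict c {1..n}) \<subseteq> Pi\<^sub>E {1..n} V"
        using c by (intro PiE_mono) auto
      then have "restrict c {1..n} \<in> \<C>"
        using c V(3) by (auto simp: \<C>_def)
      with xc show "x \<in> (\<Union>b\<in>\<C>. Pi\<^sub>E {1..n} b)" by blast
    qed (auto simp: \<C>_def)
    ultimately show ?thesis
      by (blast intro: sets.countable_UN'')
  qed
  moreover have "space (Rn n) = ?S" by (simp add: space_PiM)
  ultimately show "sigma_sets ?S ?O \<subseteq> sets (Rn n)"
    using sets.sigma_sets_subset[of ?O "Rn n"] by auto
qed

definition random_vector :: "nat \<Rightarrow> (nat \<Rightarrow> 'a \<Rightarrow> real) \<Rightarrow> 'a \<Rightarrow> nat \<Rightarrow> real" where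
  "random_vector n X \<omega> = (\<lambda>i\<in>{1..n}. X i \<omega>)"

text \<open>Only meaningful for measurable \<open>X 1, \<dots>, X n\<close>, which has to be assumed separately.\<close>

definition exchangeable :: "'a measure \<Rightarrow> nat \<Rightarrow> (nat \<Rightarrow> 'a \<Rightarrow> real) \<Rightarrow> bool" where
  "exchangeable M n X \<longleftrightarrow>
     (\<forall>\<pi>. \<pi> permutes {1..n} \<longrightarrow>
        distr M (Rn n) (random_vector n (\<lambda>i. X (\<pi> i))) = distr M (Rn n) (random_vector n X))"

text \<open>\<open>order_statistic n X i\<close> is the \<open>i\<close>-th smallest of \<open>X 1, \<dots>, X n\<close>, meaningful for \<open>i \<in> {1..n}\<close>.\<close>

definition order_statistic :: "nat \<Rightarrow> (nat \<Rightarrow> 'a \<Rightarrow> real) \<Rightarrow> nat \<Rightarrow> 'a \<Rightarrow> real" where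
  "order_statistic n X i \<omega> = sort (map (\<lambda>j. X j \<omega>) [1..<Suc n]) ! (i - 1)"

text \<open>
  The conditional probability of the event \<open>{\<omega>. Z \<omega> \<in> B}\<close> given the \<open>\<sigma>\<close>-algebra generated by
  a random element \<open>Y\<close> with values in \<open>N\<close>. Measurability of \<open>Y\<close> is needed for the generated
  \<open>\<sigma>\<close>-algebra to be a subalgebra of \<open>M\<close>; otherwise \<open>real_cond_exp\<close> is zero by convention.
\<close>

definition cond_prob_given ::
    "'a measure \<Rightarrow> ('a \<Rightarrow> 'c) \<Rightarrow> 'c set \<Rightarrow> 'b measure \<Rightarrow> ('a \<Rightarrow> 'b) \<Rightarrow> 'a \<Rightarrow> real" where
  "cond_prob_given M Z B N Y =
     real_cond_exp M (vimage_algebra (space M) Y N) (\<lambda>\<omega>. indicator B (Z \<omega>))"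

end

theory Submission
  imports Defs
begin

text \<open>
  Since \<open>Y\<close> is a pointwise permutation of \<open>X\<close>, reindexing the sum shows that the right-hand side
  equals the average of \<open>I\<^sub>B(X \<circ> \<pi>)\<close> over all \<open>\<pi>\<close>. An event in \<open>\<sigma>(Y)\<close> has the form
  \<open>s(X) \<in> C\<close> for the sorting map \<open>s\<close>, and \<open>s(X \<circ> \<pi>) = s(X)\<close>, so by exchangeability all the
  \<open>X \<circ> \<pi>\<close> give the same integral of \<open>I\<^sub>B\<close> over this event.
\<close>

text \<open>The order statistics as a deterministic map of a point of \<open>Rn n\<close>. This lets
  \<open>Y\<close> be written as a measurable function of \<open>X\<close>, so that events about
  \<open>Y\<close> become events about \<open>X\<close>.\<close>

definition sort_vec :: "nat \<Rightarrow> (nat \<Rightarrow> real) \<Rightarrow> nat \<Rightarrow> real" where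
  "sort_vec n x = (\<lambda>i\<in>{1..n}. sort (map x [1..<Suc n]) ! (i - 1))"

lemma mset_set_1_upto: "mset_set {1..n} = mset [1..<Suc n]"
  by (metis atLeastLessThanSuc_atLeastAtMost mset_upt)

lemma mset_map_permutes:
  assumes "\<pi> permutes {1..n}"
  shows "mset (map (\<lambda>i. x (\<pi> i)) [1..<Suc n]) = mset (map x [1..<Suc n])"
  using permutes_implies_image_mset_eq[OF assms, of "\<lambda>i. x (\<pi> i)" x]
  by (simp only: mset_set_1_upto mset_map)

text \<open>Sorting sees only the multiset of the coordinates, which a permutation does not
  change.\<close>

lemma sort_vec_permute:
  assumes "\<pi> permutes {1..n}"
  shows "sort_vec n (\<lambda>i\<in>{1..n}. x (\<pi> i)) = sort_vec n x"
proof -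
  have "map (\<lambda>i\<in>{1..n}. x (\<pi> i)) [1..<Suc n] = map (\<lambda>i. x (\<pi> i)) [1..<Suc n]"
    by (intro map_cong) auto
  then have "mset (map (\<lambda>i\<in>{1..n}. x (\<pi> i)) [1..<Suc n]) = mset (map x [1..<Suc n])"
    by (simp only: mset_map_permutes[OF assms])
  then have "sort (map (\<lambda>i\<in>{1..n}. x (\<pi> i)) [1..<Suc n]) = sort (map x [1..<Suc n])"
    by (metis mset_sort properties_for_sort sorted_sort)
  then show ?thesis
    unfolding sort_vec_def by simp
qed

text \<open>Two functions on a finite set with the same multiset of values differ by a permutation
  of that set. The permutation depends on \<open>x\<close> and need not be unique when coordinates
  tie.\<close>

lemma ex_permutes_sort_vec:
  obtains \<tau> where "\<tau> permutes {1..n}" "\<And>i. i \<in> {1..n} \<Longrightarrow> sort_vec n x i = x (\<tau> i)"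
proof -
  have "map (sort_vec n x) [1..<Suc n] = sort (map x [1..<Suc n])"
    by (rule nth_equalityI) (auto simp: sort_vec_def nth_append simp del: upt_Suc)
  then have "mset (map (sort_vec n x) [1..<Suc n]) = mset (map x [1..<Suc n])"
    by (simp only: mset_sort)
  then have "image_mset (sort_vec n x) (mset_set {1..n}) = image_mset x (mset_set {1..n})"
    by (simp only: mset_set_1_upto mset_map)
  from image_mset_eq_implies_permutes[OF _ this] show ?thesis
    using that by (metis finite_atLeastAtMost)
qed

lemma sort_vec_mono:
  assumes "i \<in> {1..n}" "j \<in> {1..n}" "i \<le> j"
  shows "sort_vec n x i \<le> sort_vec n x j"
  using assms by (auto simp: sort_vec_def simp del: upt_Suc intro!: sorted_nth_mono)

lemma sort_vec_of_mono:
  assumes "\<And>i j. i \<in> {1..n} \<Longrightarrow> j \<in> {1..n} \<Longrightarrow> i \<le> j \<Longrightarrow> x i \<le> x j" and i: "i \<in> {1..n}"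
  shows "sort_vec n x i = x i"
proof -
  have "sorted (map x [1..<Suc n])"
    using assms(1) by (auto simp: sorted_iff_nth_mono simp del: upt_Suc)
  then have "sort (map x [1..<Suc n]) = map x [1..<Suc n]"
    by (simp only: sorted_sort_id)
  then show ?thesis
    using i by (auto simp: sort_vec_def simp del: upt_Suc)
qed

text \<open>Serves measurability: the sorting algorithm is replaced by a finite disjunction over
  candidate sorting permutations, each condition being finitely many inequalities between
  coordinates.\<close>

lemma sort_vec_le_iff:
  assumes i: "i \<in> {1..n}"
  shows "sort_vec n x i \<le> a \<longleftrightarrow>
    (\<exists>\<tau>\<in>{\<tau>. \<tau> permutes {1..n}}.
      (\<forall>j\<in>{1..n}. \<forall>k\<in>{j..n}. x (\<tau> j) \<le> x (\<tau> k)) \<and> x (\<tau> i) \<le> a)"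
proof
  assume a: "sort_vec n x i \<le> a"
  obtain \<tau> where \<tau>: "\<tau> permutes {1..n}" "\<And>j. j \<in> {1..n} \<Longrightarrow> sort_vec n x j = x (\<tau> j)"
    using ex_permutes_sort_vec[of n x] by blast
  have "x (\<tau> j) \<le> x (\<tau> k)" if "j \<in> {1..n}" "k \<in> {j..n}" for j k
    using sort_vec_mono[of j n k x] \<tau>(2)[of j] \<tau>(2)[of k] that by auto
  then show "\<exists>\<tau>\<in>{\<tau>. \<tau> permutes {1..n}}.
      (\<forall>j\<in>{1..n}. \<forall>k\<in>{j..n}. x (\<tau> j) \<le> x (\<tau> k)) \<and> x (\<tau> i) \<le> a"
    using \<tau> a i by auto
next
  assume "\<exists>\<tau>\<in>{\<tau>. \<tau> permutes {1..n}}.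
      (\<forall>j\<in>{1..n}. \<forall>k\<in>{j..n}. x (\<tau> j) \<le> x (\<tau> k)) \<and> x (\<tau> i) \<le> a"
  then obtain \<tau> where \<tau>: "\<tau> permutes {1..n}" "x (\<tau> i) \<le> a"
    and mono: "\<And>j k. j \<in> {1..n} \<Longrightarrow> k \<in> {j..n} \<Longrightarrow> x (\<tau> j) \<le> x (\<tau> k)"
    by blast
  \<comment> \<open>The rearranged vector is already monotone, so sorting fixes it; by invariance
    this is also the sorted version of \<open>x\<close>.\<close>
  have "sort_vec n (\<lambda>i\<in>{1..n}. x (\<tau> i)) i = (\<lambda>i\<in>{1..n}. x (\<tau> i)) i"
    using mono by (intro sort_vec_of_mono i) auto
  then show "sort_vec n x i \<le> a"
    using \<tau>(2) i unfolding sort_vec_permute[OF \<tau>(1)] by simp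
qed

lemma measurable_permute_vec:
  assumes "\<pi> permutes {1..n}"
  shows "(\<lambda>x. \<lambda>i\<in>{1..n}. x (\<pi> i)) \<in> Rn n \<rightarrow>\<^sub>M Rn n"
  using permutes_in_image[OF assms]
  by (intro measurable_restrict measurable_component_singleton) auto

lemma measurable_sort_vec: "sort_vec n \<in> Rn n \<rightarrow>\<^sub>M Rn n"
  unfolding sort_vec_def
proof (rule measurable_restrict)
  fix i assume i: "i \<in> {1..n}"
  have "(\<lambda>x. sort_vec n x i) \<in> borel_measurable (Rn n)"
    unfolding borel_measurable_iff_le sort_vec_le_iff[OF i]
  proof
    fix a :: real
    show "{x \<in> space (Rn n). \<exists>\<tau>\<in>{\<tau>. \<tau> permutes {1..n}}.
      (\<forall>j\<in>{1..n}. \<forall>k\<in>{j..n}. x (\<tau> j) \<le> x (\<tau> k)) \<and> x (\<tau> i) \<le> a} \<in> sets (Rn n)"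
    proof (intro sets.sets_Collect_finite_Ex)
      fix \<tau> assume "\<tau> \<in> {\<tau>. \<tau> permutes {1..n}}"
      then have comp: "(\<lambda>x. x (\<tau> j)) \<in> borel_measurable (Rn n)" if "j \<in> {1..n}" for j
        using permutes_in_image[of \<tau> "{1..n}" j] that
        by (intro measurable_component_singleton) auto
      show "{x \<in> space (Rn n). (\<forall>j\<in>{1..n}. \<forall>k\<in>{j..n}. x (\<tau> j) \<le> x (\<tau> k)) \<and> x (\<tau> i) \<le> a}
          \<in> sets (Rn n)"
        using i by (intro sets.sets_Collect_conj sets.sets_Collect_finite_All'
            borel_measurable_le borel_measurable_const comp) auto
    qed (simp add: finite_permutations)
  qed
  then show "(\<lambda>x. sort (map x [1..<Suc n]) ! (i - 1)) \<in> borel_measurable (Rn n)"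
    using i by (simp add: sort_vec_def del: upt_Suc)
qed

text \<open>For fixed \<open>x\<close> one permutation \<tau> sorts \<open>x\<close>, and left
  composition with \<tau> is a bijection of the set of permutations, so it merely reindexes the
  sum.\<close>

lemma sum_indicator_sort_vec:
  "(\<Sum>\<pi> | \<pi> permutes {1..n}. indicator B (\<lambda>i\<in>{1..n}. sort_vec n x (\<pi> i)) :: real) =
   (\<Sum>\<pi> | \<pi> permutes {1..n}. indicator B (\<lambda>i\<in>{1..n}. x (\<pi> i)))"
proof -
  obtain \<tau> where \<tau>: "\<tau> permutes {1..n}" "\<And>i. i \<in> {1..n} \<Longrightarrow> sort_vec n x i = x (\<tau> i)"
    using ex_permutes_sort_vec[of n x] by blast
  have "(\<lambda>i\<in>{1..n}. sort_vec n x (\<pi> i)) = (\<lambda>i\<in>{1..n}. x ((\<tau> \<circ> \<pi>) i))"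
    if "\<pi> permutes {1..n}" for \<pi>
    using permutes_in_image[OF that] \<tau>(2) by (intro restrict_ext) auto
  then have "(\<Sum>\<pi> | \<pi> permutes {1..n}. indicator B (\<lambda>i\<in>{1..n}. sort_vec n x (\<pi> i)) :: real) =
      (\<Sum>\<pi> | \<pi> permutes {1..n}. indicator B (\<lambda>i\<in>{1..n}. x ((\<tau> \<circ> \<pi>) i)))"
    by (intro sum.cong) auto
  also have "\<dots> = (\<Sum>\<pi> | \<pi> permutes {1..n}. indicator B (\<lambda>i\<in>{1..n}. x (\<pi> i)))"
    by (rule setum_permutations_compose_left[OF \<tau>(1), symmetric])
  finally show ?thesis .
qed

theorem corollary1:
  fixes M :: "'a measure" and n :: nat and X Y :: "nat \<Rightarrow> 'a \<Rightarrow> real"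
    and B :: "(nat \<Rightarrow> real) set"
  assumes "prob_space M"
    and "n \<ge> 1"
    and "\<And>i. i \<in> {1..n} \<Longrightarrow> X i \<in> borel_measurable M"
    and "exchangeable M n X"
    and "\<And>i. i \<in> {1..n} \<Longrightarrow> Y i = order_statistic n X i"
    and "B \<in> sets (Rn n)"
  shows "AE \<omega> in M.
           cond_prob_given M (random_vector n X) B (Rn n) (random_vector n Y) \<omega> =
           1 / fact n * (\<Sum>\<pi> | \<pi> permutes {1..n}. indicator B (random_vector n (\<lambda>i. Y (\<pi> i)) \<omega>))"
proof -
  interpret prob_space M by fact
  define P where "P = {\<pi>. \<pi> permutes {1..n}}"
  have card_P: "card P = fact n" and fin_P: "finite P"
    unfolding P_def by (simp_all add: card_permutations finite_permutations)
  define V W where "V = random_vector n X" and "W = random_vector n Y"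
  let ?p = "\<lambda>\<pi> (x :: nat \<Rightarrow> real). \<lambda>i\<in>{1..n}. x (\<pi> i)"
  let ?F = "vimage_algebra (space M) W (Rn n)"
  note [measurable] = \<open>B \<in> sets (Rn n)\<close> measurable_sort_vec
  have p_meas [measurable]: "?p \<pi> \<in> Rn n \<rightarrow>\<^sub>M Rn n" if "\<pi> \<in> P" for \<pi>
    using that measurable_permute_vec by (simp add: P_def)
  have V [measurable]: "V \<in> M \<rightarrow>\<^sub>M Rn n"
    unfolding V_def random_vector_def by (intro measurable_restrict assms(3))
  have W_eq: "W = (\<lambda>\<omega>. sort_vec n (V \<omega>))"
  proof
    fix \<omega>
    have "map (V \<omega>) [1..<Suc n] = map (\<lambda>j. X j \<omega>) [1..<Suc n]"
      by (intro map_cong) (auto simp: V_def random_vector_def)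
    then show "W \<omega> = sort_vec n (V \<omega>)"
      unfolding W_def random_vector_def sort_vec_def
      by (intro restrict_ext) (simp only: assms(5) order_statistic_def)
  qed
  have W [measurable]: "W \<in> M \<rightarrow>\<^sub>M Rn n"
    unfolding W_eq by measurable
  have W_F [measurable]: "W \<in> ?F \<rightarrow>\<^sub>M Rn n"
    using measurable_space[OF W] by (intro measurable_vimage_algebra1) auto
  \<comment> \<open>Since \<pi> maps \<open>{1..n}\<close> into itself, the value
    \<open>undefined\<close> taken by \<open>V\<close> and \<open>W\<close> outside this set is
    never read.\<close>
  have V_perm: "random_vector n (\<lambda>i. X (\<pi> i)) = (\<lambda>\<omega>. ?p \<pi> (V \<omega>))"
    and W_perm: "random_vector n (\<lambda>i. Y (\<pi> i)) = (\<lambda>\<omega>. ?p \<pi> (W \<omega>))" if "\<pi> \<in> P" for \<pi>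
    using permutes_in_image[of \<pi> "{1..n}"] that
    by (auto simp: V_def W_def random_vector_def P_def fun_eq_iff restrict_def)
  \<comment> \<open>The claimed version of the conditional probability. Written through
    \<open>W\<close> it is visibly measurable for \<open>?F\<close>; rewritten through
    \<open>V\<close> in \<open>g_eq\<close> it is open to exchangeability.\<close>
  define g where "g = (\<lambda>\<omega>. 1 / fact n * (\<Sum>\<pi>\<in>P. indicator B (?p \<pi> (W \<omega>))) :: real)"
  have g_eq: "g = (\<lambda>\<omega>. 1 / fact n * (\<Sum>\<pi>\<in>P. indicator B (?p \<pi> (V \<omega>))))"
    unfolding g_def P_def W_eq by (simp only: sum_indicator_sort_vec)
  have sub: "subalgebra M ?F"
    unfolding subalgebra_def using measurable_space[OF W]
    by (auto simp: sets_vimage_algebra2 intro!: measurable_sets[OF W])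
  interpret finite_measure_subalgebra M ?F
    by unfold_locales (rule sub)
  \<comment> \<open>Exchangeability enters here: both integrals are the mass that one common law on
    \<open>Rn n\<close> gives to \<open>E\<close>.\<close>
  have perm_integral: "(\<integral>\<omega>. indicator E (?p \<pi> (V \<omega>)) \<partial>M) = (\<integral>\<omega>. indicator E (V \<omega>) \<partial>M :: real)"
    if \<pi>: "\<pi> \<in> P" and [measurable]: "E \<in> sets (Rn n)" for \<pi> E
  proof -
    note [measurable] = p_meas[OF \<pi>]
    have "(\<integral>\<omega>. indicator E (?p \<pi> (V \<omega>)) \<partial>M) = (\<integral>x. indicator E x \<partial>distr M (Rn n) (\<lambda>\<omega>. ?p \<pi> (V \<omega>)) :: real)"
      by (subst integral_distr) measurable
    also have "distr M (Rn n) (\<lambda>\<omega>. ?p \<pi> (V \<omega>)) = distr M (Rn n) V"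
      using \<open>exchangeable M n X\<close> \<pi> unfolding exchangeable_def V_perm[OF \<pi>, symmetric]
      by (simp add: P_def V_def)
    also have "(\<integral>x. indicator E x \<partial>\<dots>) = (\<integral>\<omega>. indicator E (V \<omega>) \<partial>M :: real)"
      by (subst integral_distr) measurable
    finally show ?thesis .
  qed
  have int: "integrable M (\<lambda>\<omega>. indicator E (h (V \<omega>)) :: real)"
    if [measurable]: "E \<in> sets (Rn n)" "h \<in> Rn n \<rightarrow>\<^sub>M Rn n" for E h
    by (rule integrable_const_bound[where B = 1]) auto
  have "AE \<omega> in M. real_cond_exp M ?F (\<lambda>\<omega>. indicator B (V \<omega>)) \<omega> = g \<omega>"
  \<comment> \<open>Besides integrability and measurability for \<open>?F\<close>, it remains to
    compare the integrals over every event of \<open>?F\<close>.\<close>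
  proof (rule real_cond_exp_charact)
    show "integrable M (\<lambda>\<omega>. indicator B (V \<omega>) :: real)"
      by (intro int[of B "\<lambda>x. x"]) measurable
    show "integrable M g"
      unfolding g_eq by (intro integrable_mult_right Bochner_Integration.integrable_sum int p_meas
          \<open>B \<in> sets (Rn n)\<close>)
    show "g \<in> borel_measurable ?F"
      unfolding g_def
      by (intro borel_measurable_times borel_measurable_const borel_measurable_sum
          measurable_compose[OF measurable_compose[OF W_F p_meas]] borel_measurable_indicator
          \<open>B \<in> sets (Rn n)\<close>)
    fix A assume "A \<in> sets ?F"
    then obtain C where C [measurable]: "C \<in> sets (Rn n)" and A: "A = W -` C \<inter> space M"
      using measurable_space[OF W] by (auto simp: sets_vimage_algebra2)
    \<comment> \<open>Chosen so that the event \<open>A\<close> together with \<open>V\<close> lying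
      in \<open>B\<close> is the single event that \<open>V\<close> lies in
      \<open>E\<close>.\<close>
    define E where "E = B \<inter> (sort_vec n -` C \<inter> space (Rn n))"
    have E [measurable]: "E \<in> sets (Rn n)"
      unfolding E_def by measurable
    \<comment> \<open>Permuting \<open>V\<close> leaves its sorted version, hence membership in
      \<open>A\<close>, unchanged; thus the same \<open>E\<close> works for every \<pi>.\<close>
    have A_iff: "indicator A \<omega> * indicator B (?p \<pi> (V \<omega>)) = (indicator E (?p \<pi> (V \<omega>)) :: real)"
      if "\<pi> \<in> P" "\<omega> \<in> space M" for \<pi> \<omega>
      using that measurable_space[OF measurable_compose[OF V p_meas[OF that(1)]] that(2)]
        sort_vec_permute[of \<pi> n "V \<omega>"]
      by (auto simp: A E_def W_eq P_def split: split_indicator)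
    \<comment> \<open>Makes the unpermuted integrand the case \<pi> = \<open>id\<close> of
      \<open>A_iff\<close>.\<close>
    have id: "id \<in> P" and p_id: "?p id (V \<omega>) = V \<omega>" for \<omega>
      by (auto simp: P_def permutes_id V_def random_vector_def)
    have "(\<integral>\<omega>\<in>A. indicator B (V \<omega>) \<partial>M) = (\<integral>\<omega>. indicator E (V \<omega>) \<partial>M :: real)"
      unfolding set_lebesgue_integral_def
      using A_iff[OF id] by (intro Bochner_Integration.integral_cong) (simp_all only: p_id real_scaleR_def)
    \<comment> \<open>All \<open>fact n\<close> summands equal the integral on the left, so
      averaging them changes nothing.\<close>
    also have "\<dots> = 1 / fact n * (\<Sum>\<pi>\<in>P. \<integral>\<omega>. indicator E (?p \<pi> (V \<omega>)) \<partial>M)"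
      using perm_integral[OF _ E] by (simp add: card_P del: One_nat_def)
    also have "\<dots> = (\<integral>\<omega>. 1 / fact n * (\<Sum>\<pi>\<in>P. indicator E (?p \<pi> (V \<omega>))) \<partial>M)"
      by (subst integral_mult_right_zero, subst Bochner_Integration.integral_sum)
        (intro int p_meas E refl | assumption)+
    \<comment> \<open>\<open>A_iff\<close> read backwards: the indicator of \<open>A\<close> is
      common to all summands and factors out, leaving \<open>g\<close>.\<close>
    also have "\<dots> = (\<integral>\<omega>\<in>A. g \<omega> \<partial>M)"
      unfolding set_lebesgue_integral_def g_eq
      by (intro Bochner_Integration.integral_cong)
        (simp_all add: sum_distrib_left A_iff[symmetric] mult_ac del: One_nat_def)
    finally show "(\<integral>\<omega>\<in>A. indicator B (V \<omega>) \<partial>M) = (\<integral>\<omega>\<in>A. g \<omega> \<partial>M)" .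
  qed
  moreover have "g = (\<lambda>\<omega>. 1 / fact n * (\<Sum>\<pi>\<in>P. indicator B (random_vector n (\<lambda>i. Y (\<pi> i)) \<omega>)))"
    unfolding g_def by (simp add: W_perm)
  ultimately show ?thesis
    unfolding cond_prob_given_def V_def[symmetric] W_def[symmetric] by (simp add: P_def)
qed

end
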